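(* For every $p\in[0,1]$, the capacity $C_p$ of the class $\mathsf{CE}_p$ of $p$-bounded causal binary erasure channels satisfies $$C_p\;\le\;(1-2p)^{+},$$ where $(x)^+=\max(x,0)$ for $x\in\mathbb{R}$.
   Context: Alphabets: $\mathcal{X}=\{0,1\}$, $\mathcal{Y}=\{0,1,\wedge\}$, where $\wedge$ denotes an erasure. Causal erasure channels. For $p\in[0,1]$ and blocklength $n$, a channel $\mathbf{Adv}\in\mathsf{CE}_p$ is given by (possibly randomized) functions $\mathrm{Adv}^i:\mathcal{X}^i\times\mathcal{Y}^{i-1}\to\mathcal{Y}$, $i=1,\dots,n$. At time $i$ the channel maps the inputs $x_1,\dots,x_i$ observed so far and its own previous outputs $y_1,\dots,y_{i-1}$ to an output symbol $y_i\in\{x_i,\wedge\}$, subject to the constraint that the total number of erased symbols in $\mathbf{y}=(y_1,\dots,y_n)$ is at most $pn$. Apart from causality and this bound, the channel's behavior is arbitrary. Write $\mathbf{Adv}(\mathbf{x})$ for the (random) output word when the input is $\mathbf{x}\in\mathcal{X}^n$. Codes. For $R\ge 0$, a $(2^{nR},n)$ code is a pair $(\mathsf{Enc},\mathsf{Dec})$ with message set $\mathcal{U}=\{0,1\}^{\lceil nR\rceil}$, a stochastic encoder $\mathsf{Enc}:\mathcal{U}\to\mathcal{X}^n$ and a (possibly randomized) decoder $\mathsf{Dec}:\mathcal{Y}^n\to\mathcal{U}$. Encoder and decoder share no randomness. The encoder is assumed injective: for all distinct messages $u,u'$, $\mathsf{Enc}(u)\ne\mathsf{Enc}(u')$ with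 probability $1$ (i.e. the sets of possible codewords of distinct messages are disjoint). Error probability. For a code and a channel, $$P_{\max}^n=\max_{u\in\mathcal{U}}\sum_{\mathbf{x}\in\mathcal{X}^n}\Pr(\mathsf{Enc}(u)=\mathbf{x})\sum_{\mathbf{y}\in\mathcal{Y}^n}\Pr(\mathbf{Adv}(\mathbf{x})=\mathbf{y})\Pr(\mathsf{Dec}(\mathbf{y})\ne u).$$ Achievability and capacity. A rate $R\ge 0$ is achievable for $\mathsf{CE}_p$ if for every $\epsilon>0$ there is a sequence, indexed by $n\ge1$, of $(2^{n(R-\epsilon)},n)$ codes (with a single-message set if $R-\epsilon\le 0$) such that for every $\beta>0$ there is an integer $n_\beta$ such that for all $\mathbf{Adv}\in\mathsf{CE}_p$, $P_{\max}^n<\beta$ for all $n>n_\beta$. (In particular the channel may depend on the code.) The capacity $C_p$ is the supremum of all achievable rates for $\mathsf{CE}_p$. *)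

theory Defs
  imports "HOL-Probability.Probability"
begin

text \<open>An output symbol is \<open>None\<close> for an erasure and \<open>Some b\<close> for a received bit \<open>b\<close>.\<close>

type_synonym in_sym = bool
type_synonym out_sym = "bool option"
type_synonym message = "bool list"

definition words :: "nat \<Rightarrow> 'a list set" where
  "words n = {w. length w = n}"

text \<open>
  \<open>adv xs ys\<close> is the law of the \<open>i\<close>-th output symbol, where \<open>i = length xs\<close>, \<open>xs\<close> is the list of
  inputs up to and including time \<open>i\<close>, and \<open>ys\<close> the list of the \<open>i - 1\<close> earlier outputs (both in
  chronological order).  The values at other pairs of lengths are never used.
\<close>

type_synonym adversary = "in_sym list \<Rightarrow> out_sym list \<Rightarrow> out_sym pmf"

primrec output_prefix :: "adversary \<Rightarrow> in_sym list \<Rightarrow> nat \<Rightarrow> out_sym list pmf" where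
  "output_prefix adv x 0 = return_pmf []"
| "output_prefix adv x (Suc i) =
     bind_pmf (output_prefix adv x i)
       (\<lambda>ys. map_pmf (\<lambda>y. ys @ [y]) (adv (take (Suc i) x) ys))"

definition channel_output :: "adversary \<Rightarrow> in_sym list \<Rightarrow> out_sym list pmf" where
  "channel_output adv x = output_prefix adv x (length x)"

definition CE :: "real \<Rightarrow> nat \<Rightarrow> adversary set" where
  "CE p n = {adv.
     (\<forall>xs ys. length xs \<le> n \<and> length xs = Suc (length ys) \<longrightarrow>
        set_pmf (adv xs ys) \<subseteq> {Some (last xs), None}) \<and>
     (\<forall>x \<in> words n. \<forall>y \<in> set_pmf (channel_output adv x).
        real (count_list y None) \<le> p * real n)}"

text \<open>For \<open>R \<le> 0\<close> the truncation by \<open>nat\<close> makes the empty word the only message.\<close>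

definition messages :: "real \<Rightarrow> nat \<Rightarrow> message set" where
  "messages R n = words (nat \<lceil>real n * R\<rceil>)"

type_synonym encoder = "message \<Rightarrow> in_sym list pmf"
type_synonym decoder = "out_sym list \<Rightarrow> message pmf"

definition is_code :: "real \<Rightarrow> nat \<Rightarrow> encoder \<Rightarrow> decoder \<Rightarrow> bool" where
  "is_code R n enc dec \<longleftrightarrow>
     (\<forall>u \<in> messages R n. set_pmf (enc u) \<subseteq> words n) \<and>
     (\<forall>u \<in> messages R n. \<forall>u' \<in> messages R n. u \<noteq> u' \<longrightarrow>
        set_pmf (enc u) \<inter> set_pmf (enc u') = {}) \<and>
     (\<forall>y \<in> words n. set_pmf (dec y) \<subseteq> messages R n)"

definition max_error :: "real \<Rightarrow> nat \<Rightarrow> encoder \<Rightarrow> decoder \<Rightarrow> adversary \<Rightarrow> real" where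
  "max_error R n enc dec adv =
     Max ((\<lambda>u. \<Sum>x \<in> words n. pmf (enc u) x *
            (\<Sum>y \<in> words n. pmf (channel_output adv x) y *
              measure_pmf.prob (dec y) {u'. u' \<noteq> u})) ` messages R n)"

definition achievable :: "real \<Rightarrow> real \<Rightarrow> bool" where
  "achievable p R \<longleftrightarrow>
     (\<forall>\<epsilon>>0. \<exists>(enc :: nat \<Rightarrow> encoder) (dec :: nat \<Rightarrow> decoder).
        (\<forall>n\<ge>1. is_code (R - \<epsilon>) n (enc n) (dec n)) \<and>
        (\<forall>\<beta>>0. \<exists>N. \<forall>n>N. \<forall>adv \<in> CE p n.
           max_error (R - \<epsilon>) n (enc n) (dec n) adv < \<beta>))"

text \<open>The supremum is taken in \<^typ>\<open>ereal\<close>, where it exists without a boundedness proof.\<close>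

definition capacity :: "real \<Rightarrow> ereal" where
  "capacity p = (SUP R \<in> {R. R \<ge> 0 \<and> achievable p R}. ereal R)"

lemma finite_words: "finite (words n :: 'a::finite list set)"
  using finite_lists_length_eq[of "UNIV :: 'a set" n] by (simp add: words_def)

lemma words_nonempty: "words n \<noteq> {}"
proof -
  have "replicate n undefined \<in> words n" by (simp add: words_def)
  then show ?thesis by blast
qed

lemma output_prefix_words: "set_pmf (output_prefix adv x i) \<subseteq> words i"
  by (induction i) (auto simp: words_def)

lemma channel_output_words: "set_pmf (channel_output adv x) \<subseteq> words (length x)"
  using output_prefix_words by (simp add: channel_output_def)

lemma zero_achievable: "achievable p 0"
proof -
  have m: "messages (0 - \<epsilon>) n = {[]}" if "\<epsilon> > 0" for \<epsilon> n
  proof -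
    have "\<lceil>real n * (0 - \<epsilon>)\<rceil> \<le> 0" using that by (simp add: ceiling_le_zero)
    then show ?thesis by (auto simp: messages_def words_def)
  qed
  show ?thesis unfolding achievable_def
  proof (intro allI impI)
    fix \<epsilon> :: real assume e: "\<epsilon> > 0"
    let ?enc = "\<lambda>n u. return_pmf (replicate n False)" and ?dec = "\<lambda>n y. return_pmf []"
    have "max_error (0 - \<epsilon>) n (?enc n) (?dec n) adv = 0" for n adv
      unfolding max_error_def m[OF e] by simp
    moreover have "is_code (0 - \<epsilon>) n (?enc n) (?dec n)" for n
      unfolding is_code_def m[OF e] by (simp add: words_def)
    ultimately show "\<exists>(enc :: nat \<Rightarrow> encoder) (dec :: nat \<Rightarrow> decoder).
        (\<forall>n\<ge>1. is_code (0 - \<epsilon>) n (enc n) (dec n)) \<and>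
        (\<forall>\<beta>>0. \<exists>N. \<forall>n>N. \<forall>adv \<in> CE p n. max_error (0 - \<epsilon>) n (enc n) (dec n) adv < \<beta>)"
      by (intro exI[of _ ?enc] exI[of _ ?dec]) simp
  qed
qed

end

(*
  The adversary forwards the first l symbols, with l slightly larger than (1 - 2p) n, and then
  fixes a second codeword x' compatible with the prefix w it has seen, as a function of w only.
  From there on it erases the positions where the input x differs from x', as long as the budget
  allows.  If x and x' differ in at most p n positions, the output is symmetric in x and x', so
  the decoder fails on one of the two messages.
  Suppose the message is uniform and x' is drawn from the law of x given w.  Two words drawn
  independently from this law differ in at most (n - l) / 2 positions on average (Plotkin), so by
  Markov's inequality they are within the budget with probability bounded away from 0; they belong
  to the same message with small probability, since there are far more messages than prefixes.
  Finally x' is derandomised by taking the best choice for each prefix.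
*)
theory Submission
  imports Defs
begin

section \<open>Erasing the disagreements of two words\<close>

text \<open>The output aimed at by the attack: being symmetric in the two words, it does not reveal
  which of them was sent.\<close>

definition erase_diff :: "bool list \<Rightarrow> bool list \<Rightarrow> out_sym list" where
  "erase_diff x x' = map2 (\<lambda>a b. if a = b then Some a else None) x x'"

lemma length_erase_diff [simp]: "length (erase_diff x x') = min (length x) (length x')"
  by (simp add: erase_diff_def)

lemma nth_erase_diff:
  "i < length x \<Longrightarrow> i < length x' \<Longrightarrow>
    erase_diff x x' ! i = (if x ! i = x' ! i then Some (x ! i) else None)"
  by (simp add: erase_diff_def)

lemma erase_diff_commute: "length x = length x' \<Longrightarrow> erase_diff x x' = erase_diff x' x"
  by (auto intro!: nth_equalityI simp: nth_erase_diff)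

text \<open>A common prefix causes no erasures. The sum over positions lets the Plotkin bound be
  applied to one position at a time.\<close>

lemma count_erase_diff:
  assumes "length x = n" "length x' = n" "take l x = take l x'"
  shows "real (count_list (erase_diff x x') None) = (\<Sum>i\<in>{l..<n}. of_bool (x ! i \<noteq> x' ! i))"
proof -
  have "count_list (erase_diff x x') None = card {i. i < n \<and> None = erase_diff x x' ! i}"
    using assms by (simp add: count_list_eq_length_filter length_filter_conv_card)
  also have "{i. i < n \<and> None = erase_diff x x' ! i} = {i \<in> {l..<n}. x ! i \<noteq> x' ! i}"
  proof -
    have "x ! i = x' ! i" if "i < l" for i using that assms(3) by (metis nth_take)
    then have "i < n \<and> None = erase_diff x x' ! i \<longleftrightarrow> i \<in> {l..<n} \<and> x ! i \<noteq> x' ! i" for i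
      using assms(1,2)
      by (cases "i < l"; cases "x ! i = x' ! i") (simp_all add: nth_erase_diff cong: conj_cong)
    then show ?thesis by blast
  qed
  finally have "count_list (erase_diff x x') None = card {i \<in> {l..<n}. x ! i \<noteq> x' ! i}" .
  then show ?thesis by (simp add: Int_def)
qed

section \<open>Plotkin averaging and the choice of a confusing word\<close>

text \<open>Plotkin bound at one position: if the two bit values have masses T and F, disagreeing
  ordered pairs have mass 2TF, and 4TF \<le> (T + F)^2.\<close>

lemma sum_disagree_le:
  fixes q :: "'a \<Rightarrow> real" and B :: "'a \<Rightarrow> bool"
  assumes "finite A"
  shows "(\<Sum>a\<in>A. \<Sum>b\<in>A. q a * q b * of_bool (B a \<noteq> B b)) \<le> (\<Sum>a\<in>A. q a)\<^sup>2 / 2"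
proof -
  let ?T = "\<Sum>a\<in>A. q a * of_bool (B a)" and ?F = "\<Sum>a\<in>A. q a * of_bool (\<not> B a)"
  have "(\<Sum>a\<in>A. \<Sum>b\<in>A. q a * q b * of_bool (B a \<noteq> B b)) =
     (\<Sum>a\<in>A. \<Sum>b\<in>A. (q a * of_bool (B a)) * (q b * of_bool (\<not> B b)) +
                     (q a * of_bool (\<not> B a)) * (q b * of_bool (B b)))"
    by (intro sum.cong refl) auto
  also have "\<dots> = 2 * ?T * ?F"
    by (simp add: sum.distrib sum_product[symmetric])
  also have "\<dots> \<le> (?T + ?F)\<^sup>2 / 2"
    using zero_le_power2[of "?T - ?F"] by (simp add: power2_eq_square field_simps)
  also have "?T + ?F = (\<Sum>a\<in>A. q a)"
    by (subst sum.distrib[symmetric]) (auto intro!: sum.cong)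
  finally show ?thesis .
qed

text \<open>A maximiser of \<open>g\<close> works. Avoiding division by the total weight keeps the
  case of weight 0, that is, of a prefix that never occurs.\<close>

lemma exists_ge_weighted_average:
  fixes q g :: "'a \<Rightarrow> real"
  assumes "finite A" "A \<noteq> {}" "\<And>a. a \<in> A \<Longrightarrow> q a \<ge> 0"
  shows "\<exists>a\<in>A. (\<Sum>a\<in>A. q a * g a) \<le> (\<Sum>a\<in>A. q a) * g a"
proof -
  have "Max (g ` A) \<in> g ` A" using assms by simp
  then obtain a where a: "a \<in> A" "g a = Max (g ` A)" by auto
  have "g b \<le> g a" if "b \<in> A" for b using a assms that by simp
  then have "(\<Sum>b\<in>A. q b * g b) \<le> (\<Sum>b\<in>A. q b * g a)"
    by (intro sum_mono mult_left_mono) (auto simp: assms)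
  then show ?thesis using a(1) by (auto simp only: sum_distrib_right)
qed

text \<open>
  \<open>A\<close> indexes the message--codeword pairs whose codeword has a given prefix, \<open>q\<close> is their
  probability, \<open>t\<close> the erasure budget, and \<open>D u y\<close> the probability of decoding \<open>y\<close> to
  something other than \<open>u\<close>.
\<close>

lemma exists_confusing_word:
  fixes q :: "'a \<Rightarrow> real" and X :: "'a \<Rightarrow> bool list" and U :: "'a \<Rightarrow> 'm"
    and D :: "'m \<Rightarrow> out_sym list \<Rightarrow> real"
  assumes A: "finite A" "A \<noteq> {}" and q: "\<And>a. a \<in> A \<Longrightarrow> q a \<ge> 0"
    and len: "\<And>a. a \<in> A \<Longrightarrow> length (X a) = n"
    and pre: "\<And>a. a \<in> A \<Longrightarrow> take l (X a) = w"
    and D0: "\<And>u y. D u y \<ge> 0"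
    and D1: "\<And>u u' y. u \<noteq> u' \<Longrightarrow> D u y + D u' y \<ge> 1"
    and \<eta>: "\<And>u. (\<Sum>a\<in>A. q a * of_bool (U a = u)) \<le> \<eta>"
    and t: "t \<ge> 0" and \<gamma>: "\<gamma> \<le> 1" and l: "real (n - l) \<le> 2 * t * (1 - \<gamma>)"
  shows "\<exists>b\<in>A. (\<gamma> * (\<Sum>a\<in>A. q a) - \<eta>) / 2 \<le>
     (\<Sum>a\<in>A. q a * (of_bool (real (count_list (erase_diff (X a) (X b)) None) \<le> t) *
                      D (U a) (erase_diff (X a) (X b))))"
proof -
  let ?d = "\<lambda>a b. real (count_list (erase_diff (X a) (X b)) None)"
  let ?D = "\<lambda>a b. D (U a) (erase_diff (X a) (X b))"
  define P where "P = (\<Sum>a\<in>A. q a)"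
  define H where "H = (\<lambda>a b. q a * q b * (of_bool (?d a b \<le> t) * ?D a b))"
  (* K is the least integer exceeding t; dividing by K instead of t covers t = 0. *)
  define K where "K = of_int \<lfloor>t\<rfloor> + (1::real)"
  have K: "K > 0" "t \<le> K" using t unfolding K_def by linarith+
  have comm: "erase_diff (X a) (X b) = erase_diff (X b) (X a)" if "a \<in> A" "b \<in> A" for a b
    using erase_diff_commute len that by metis
  have P0: "P \<ge> 0" unfolding P_def by (intro sum_nonneg q)
  have \<eta>0: "\<eta> \<ge> 0"
    by (rule order_trans[OF _ \<eta>[of undefined]]) (intro sum_nonneg mult_nonneg_nonneg q, auto)

  have "(\<Sum>a\<in>A. \<Sum>b\<in>A. q a * q b * ?d a b) =
      (\<Sum>a\<in>A. \<Sum>b\<in>A. \<Sum>i\<in>{l..<n}. q a * q b * of_bool (X a ! i \<noteq> X b ! i))"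
    using count_erase_diff len pre
    by (intro sum.cong refl) (simp add: sum_distrib_left)
  also have "\<dots> = (\<Sum>i\<in>{l..<n}. \<Sum>a\<in>A. \<Sum>b\<in>A. q a * q b * of_bool (X a ! i \<noteq> X b ! i))"
    by (simp only: sum.swap[of _ A "{l..<n}"])
  also have "\<dots> \<le> (\<Sum>i\<in>{l..<n}. P\<^sup>2 / 2)"
    unfolding P_def by (intro sum_mono sum_disagree_le A)
  also have "\<dots> = real (n - l) / 2 * P\<^sup>2" by simp
  also have "\<dots> \<le> (K * (1 - \<gamma>)) * P\<^sup>2"
    using l mult_right_mono[OF K(2), of "1 - \<gamma>"] \<gamma> by (intro mult_right_mono) auto
  finally have plotkin: "(\<Sum>a\<in>A. \<Sum>b\<in>A. q a * q b * ?d a b) \<le> K * ((1 - \<gamma>) * P\<^sup>2)"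
    by simp

  \<comment> \<open>Markov's inequality: a distance above \<open>t\<close> is an integer above
    \<lfloor>t\<rfloor>, hence at least \<open>K\<close>.\<close>
  have "K * (\<Sum>a\<in>A. \<Sum>b\<in>A. q a * q b * of_bool (?d a b > t)) =
      (\<Sum>a\<in>A. \<Sum>b\<in>A. q a * q b * (K * of_bool (?d a b > t)))"
    unfolding sum_distrib_left by (intro sum.cong refl) (simp only: mult_ac)
  also have "\<dots> \<le> (\<Sum>a\<in>A. \<Sum>b\<in>A. q a * q b * ?d a b)"
  proof (intro sum_mono mult_left_mono mult_nonneg_nonneg q)
    fix a b
    show "K * of_bool (?d a b > t) \<le> ?d a b"
    proof (cases "?d a b > t")
      case True
      then have "\<lfloor>t\<rfloor> < int (count_list (erase_diff (X a) (X b)) None)" by linarith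
      then have "K \<le> ?d a b" unfolding K_def by linarith
      then show ?thesis using True by simp
    qed simp
  qed
  also note plotkin
  finally have far: "(\<Sum>a\<in>A. \<Sum>b\<in>A. q a * q b * of_bool (?d a b > t)) \<le> (1 - \<gamma>) * P\<^sup>2"
    using K by simp

  have "(\<Sum>a\<in>A. \<Sum>b\<in>A. q a * q b * of_bool (U a = U b)) =
      (\<Sum>a\<in>A. q a * (\<Sum>b\<in>A. q b * of_bool (U b = U a)))"
    unfolding sum_distrib_left by (intro sum.cong refl) auto
  also have "\<dots> \<le> (\<Sum>a\<in>A. q a * \<eta>)"
    by (intro sum_mono mult_left_mono \<eta> q)
  also have "\<dots> = P * \<eta>" by (simp add: P_def sum_distrib_right)
  finally have same: "(\<Sum>a\<in>A. \<Sum>b\<in>A. q a * q b * of_bool (U a = U b)) \<le> P * \<eta>" .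

  \<comment> \<open>Union bound: discard the pairs beyond the budget and the pairs with equal
    messages.\<close>
  have "P\<^sup>2 - (1 - \<gamma>) * P\<^sup>2 - P * \<eta> \<le> (\<Sum>a\<in>A. \<Sum>b\<in>A. q a * q b)
      - (\<Sum>a\<in>A. \<Sum>b\<in>A. q a * q b * of_bool (?d a b > t))
      - (\<Sum>a\<in>A. \<Sum>b\<in>A. q a * q b * of_bool (U a = U b))"
    using far same by (simp add: P_def power2_eq_square sum_product)
  also have "\<dots> = (\<Sum>a\<in>A. \<Sum>b\<in>A. q a * q b * (1 - of_bool (?d a b > t) - of_bool (U a = U b)))"
    by (simp add: sum_subtractf[symmetric] algebra_simps)
  also have "\<dots> \<le> (\<Sum>a\<in>A. \<Sum>b\<in>A. H a b + H b a)"
  proof (intro sum_mono)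
    fix a b assume ab: "a \<in> A" "b \<in> A"
    \<comment> \<open>For a close pair with distinct messages, \<open>D1\<close> makes the two error
      probabilities add up to at least 1. Otherwise the left side is at most 0.\<close>
    have "1 - of_bool (?d a b > t) - of_bool (U a = U b) \<le>
        of_bool (?d a b \<le> t) * (?D a b + D (U b) (erase_diff (X a) (X b)))"
      using D1[of "U a" "U b"] D0 by (cases "U a = U b") auto
    then have "q a * q b * (1 - of_bool (?d a b > t) - of_bool (U a = U b)) \<le>
       q a * q b * (of_bool (?d a b \<le> t) * (?D a b + D (U b) (erase_diff (X a) (X b))))"
      using q ab by (intro mult_left_mono) auto
    also have "\<dots> = H a b + H b a"
      by (simp add: H_def comm[OF ab(2,1)] algebra_simps)
    finally show "q a * q b * (1 - of_bool (?d a b > t) - of_bool (U a = U b)) \<le> H a b + H b a" .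
  qed
  \<comment> \<open>Both roles of a pair carry the same total, which costs the factor 1/2 in the
    bound.\<close>
  also have "\<dots> = 2 * (\<Sum>a\<in>A. \<Sum>b\<in>A. H b a)"
    using sum.swap[of H A A] by (simp add: sum.distrib)
  finally have lower: "P * ((\<gamma> * P - \<eta>) / 2) \<le> (\<Sum>b\<in>A. \<Sum>a\<in>A. H a b)"
    by (simp add: algebra_simps power2_eq_square)

  let ?G = "\<lambda>b. \<Sum>a\<in>A. q a * (of_bool (?d a b \<le> t) * ?D a b)"
  have G0: "?G b \<ge> 0" for b
    by (intro sum_nonneg mult_nonneg_nonneg q D0) auto
  obtain b where b: "b \<in> A" "(\<Sum>b\<in>A. q b * ?G b) \<le> P * ?G b"
    using exists_ge_weighted_average[of A q ?G] A q unfolding P_def by blast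
  have "(\<Sum>b\<in>A. \<Sum>a\<in>A. H a b) = (\<Sum>b\<in>A. q b * ?G b)"
    unfolding H_def sum_distrib_left by (simp only: mult_ac)
  with lower b have *: "P * ((\<gamma> * P - \<eta>) / 2) \<le> P * ?G b" by linarith
  have "(\<gamma> * P - \<eta>) / 2 \<le> ?G b"
  \<comment> \<open>With no mass, \<open>P\<close> cannot be cancelled, but the left side is then at
    most 0.\<close>
  proof (cases "P = 0")
    case True then show ?thesis using \<eta>0 G0[of b] by simp
  next
    case False then show ?thesis using * P0 by (simp add: mult_le_cancel_left)
  qed
  with b show ?thesis unfolding P_def by blast
qed

section \<open>The causal attack and its output\<close>

text \<open>Here \<open>f\<close> maps the prefix to the second word x'. The index
  \<open>length xs - 1\<close> is the zero-based position of the current symbol. Testing the budget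
  before each erasure makes the attack admissible for every \<open>f\<close>.\<close>

definition attack :: "real \<Rightarrow> nat \<Rightarrow> (bool list \<Rightarrow> bool list) \<Rightarrow> adversary" where
  "attack t l f xs ys = return_pmf
     (if l < length xs \<and> last xs \<noteq> f (take l xs) ! (length xs - 1) \<and>
         real (count_list ys None) + 1 \<le> t
      then None else Some (last xs))"

lemma attack_in_CE:
  assumes "0 \<le> p"
  shows "attack (p * real n) l f \<in> CE p n"
proof -
  have "real (count_list y None) \<le> p * real n"
    if "y \<in> set_pmf (output_prefix (attack (p * real n) l f) x i)" for x y i
    using that
  proof (induction i arbitrary: y)
    case 0
    then show ?case using assms by simp
  next
    case (Suc i)
    then show ?case by (auto simp: attack_def split: if_splits)
  qed
  then show ?thesis unfolding CE_def channel_output_def by (auto simp: attack_def)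
qed

text \<open>When all disagreements fit into the budget, the budget test never prevents an erasure,
  so by induction each output prefix is a prefix of the merged word.\<close>

lemma channel_output_attack:
  assumes len: "length (f (take l x)) = length x" and pre: "take l (f (take l x)) = take l x"
    and t: "real (count_list (erase_diff x (f (take l x))) None) \<le> t"
  shows "channel_output (attack t l f) x = return_pmf (erase_diff x (f (take l x)))"
proof -
  let ?z = "erase_diff x (f (take l x))"
  have "output_prefix (attack t l f) x i = return_pmf (take i ?z)" if "i \<le> length x" for i
    using that
  proof (induction i)
    case (Suc i)
    then have i: "i < length x" by simp
    have z: "take (Suc i) ?z = take i ?z @ [?z ! i]"
      using i len by (simp add: take_Suc_conv_app_nth)
    have last: "last (take (Suc i) x) = x ! i"
      using i by (simp add: take_Suc_conv_app_nth)
    have "count_list (take (Suc i) ?z) None \<le> count_list ?z None"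
      by (metis append_take_drop_id count_list_append le_add1)
    \<comment> \<open>An erasure at position \<open>i\<close> is itself counted in the total, so the
      earlier ones leave room for it.\<close>
    then have room: "?z ! i = None \<Longrightarrow> real (count_list (take i ?z) None) + 1 \<le> t"
      using t z by auto
    have early: "x ! i = f (take l x) ! i" if "i < l"
      using that pre by (metis nth_take)
    have "attack t l f (take (Suc i) x) (take i ?z) = return_pmf (?z ! i)"
    proof (cases "l \<le> i")
      case True
      then have "take l (take (Suc i) x) = take l x" by (simp add: min_def)
      then show ?thesis
        using True i len room by (auto simp: attack_def last nth_erase_diff)
    next
      case False
      then show ?thesis
        using i len early by (auto simp: attack_def last nth_erase_diff)
    qed
    then show ?case using Suc z by (simp add: bind_return_pmf)
  qed simp
  from this[of "length x"] show ?thesis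
    using len by (simp add: channel_output_def)
qed

section \<open>Error forced on a fixed code\<close>

lemma card_words_bool: "card (words n :: bool list set) = 2 ^ n"
  using card_lists_length_eq[of "UNIV :: bool set" n] by (simp add: words_def)

text \<open>The maximal error dominates the error for a uniform message. A prefix of probability P
  contributes at least (\<gamma> P - 1/m) / 2 to the latter, where m is the number of messages;
  summing over the 2^l prefixes gives the bound.\<close>

lemma exists_bad_adversary:
  assumes p: "0 \<le> p" and code: "is_code r n enc dec"
    and \<gamma>: "\<gamma> \<le> 1" and ln: "l \<le> n" and l: "real (n - l) \<le> 2 * p * real n * (1 - \<gamma>)"
  shows "\<exists>adv\<in>CE p n. (\<gamma> - 2 ^ l / 2 ^ nat \<lceil>real n * r\<rceil>) / 2 \<le> max_error r n enc dec adv"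
proof -
  let ?M = "messages r n" and ?W = "words n :: bool list set" and ?V = "words l :: bool list set"
  let ?t = "p * real n"
  define m :: real where "m = 2 ^ nat \<lceil>real n * r\<rceil>"
  have finM: "finite ?M" and neM: "?M \<noteq> {}" and cardM: "real (card ?M) = m"
    by (simp_all add: messages_def finite_words words_nonempty card_words_bool m_def)
  have m: "m > 0" by (simp add: m_def)
  have finW: "finite ?W" and finV: "finite ?V" by (simp_all add: finite_words)
  \<comment> \<open>Joint law of a uniform message and its codeword.\<close>
  define q where "q = (\<lambda>(u, x). pmf (enc u) x / m)"
  define D where "D = (\<lambda>u y. measure_pmf.prob (dec y) {u'. u' \<noteq> u})"
  define A where "A = (\<lambda>w. ?M \<times> {x \<in> ?W. take l x = w})"
  have finA: "finite (A w)" for w using finM finW by (simp add: A_def)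
  have neA: "A w \<noteq> {}" if "w \<in> ?V" for w
  proof -
    have "w @ replicate (n - l) False \<in> {x \<in> ?W. take l x = w}"
      using that ln by (auto simp: words_def)
    then show ?thesis using neM by (auto simp: A_def)
  qed
  have q0: "q a \<ge> 0" for a using m by (simp add: q_def split: prod.split)
  have enc1: "(\<Sum>x\<in>?W. pmf (enc u) x) = 1" if "u \<in> ?M" for u
    using code that by (intro sum_pmf_eq_1 finW) (auto simp: is_code_def)
  have D0: "D u y \<ge> 0" for u y by (simp add: D_def)
  have D1: "D u y + D u' y \<ge> 1" if "u \<noteq> u'" for u u' y
  proof -
    have "1 = measure_pmf.prob (dec y) ({v. v \<noteq> u} \<union> {v. v \<noteq> u'})"
      using that by (simp add: Collect_disj_eq[symmetric])
    also have "\<dots> \<le> D u y + D u' y"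
      unfolding D_def by (intro measure_Un_le) auto
    finally show ?thesis .
  qed
  have \<eta>: "(\<Sum>a\<in>A w. q a * of_bool (fst a = u)) \<le> 1 / m" for w u
  proof -
    have "(\<Sum>a\<in>A w. q a * of_bool (fst a = u)) \<le> (\<Sum>a\<in>?M \<times> ?W. q a * of_bool (fst a = u))"
      using finM finW by (intro sum_mono2) (auto simp: A_def q0)
    also have "\<dots> = (\<Sum>v\<in>?M. \<Sum>x\<in>?W. pmf (enc v) x / m * of_bool (v = u))"
      unfolding sum.cartesian_product by (intro sum.cong refl) (auto simp: q_def)
    also have "\<dots> = (\<Sum>v\<in>?M. if v = u then 1 / m else 0)"
    proof (intro sum.cong refl)
      fix v assume "v \<in> ?M"
      then show "(\<Sum>x\<in>?W. pmf (enc v) x / m * of_bool (v = u)) = (if v = u then 1 / m else 0)"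
        using enc1 by (cases "v = u") (simp_all flip: sum_divide_distrib)
    qed
    also have "\<dots> \<le> 1 / m" using finM m by simp
    finally show ?thesis .
  qed
  let ?E = "\<lambda>x x'. of_bool (real (count_list (erase_diff x x') None) \<le> ?t) :: real"
  define G where "G = (\<lambda>w x'.
      \<Sum>a\<in>A w. q a * (?E (snd a) x' * D (fst a) (erase_diff (snd a) x')))"
  have "\<exists>x'. x' \<in> ?W \<and> take l x' = w \<and> (\<gamma> * (\<Sum>a\<in>A w. q a) - 1 / m) / 2 \<le> G w x'"
    if "w \<in> ?V" for w
  proof -
    have "\<exists>b\<in>A w. (\<gamma> * (\<Sum>a\<in>A w. q a) - 1 / m) / 2 \<le> G w (snd b)"
      unfolding G_def
    proof (rule exists_confusing_word[OF finA neA[OF that] q0 _ _ D0 D1 \<eta> _ \<gamma>,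
          where X = snd and n = n and l = l and w = w and t = ?t])
      show "real (n - l) \<le> 2 * ?t * (1 - \<gamma>)" using l by (simp only: mult.assoc)
    qed (use p in \<open>auto simp: A_def words_def\<close>)
    then show ?thesis by (auto simp: A_def)
  qed
  then have "\<forall>w\<in>?V. \<exists>x'. x' \<in> ?W \<and> take l x' = w \<and>
      (\<gamma> * (\<Sum>a\<in>A w. q a) - 1 / m) / 2 \<le> G w x'"
    by blast
  from bchoice[OF this] obtain f where f: "\<And>w. w \<in> ?V \<Longrightarrow> f w \<in> ?W"
    "\<And>w. w \<in> ?V \<Longrightarrow> take l (f w) = w"
    "\<And>w. w \<in> ?V \<Longrightarrow> (\<gamma> * (\<Sum>a\<in>A w. q a) - 1 / m) / 2 \<le> G w (f w)"
    by blast
  define adv where "adv = attack ?t l f"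
  define F where "F = (\<lambda>x u. \<Sum>y\<in>words n. pmf (channel_output adv x) y * D u y)"
  \<comment> \<open>Only inputs within the budget are counted; for the others the left side is
    0.\<close>
  have F: "?E x (f (take l x)) * D u (erase_diff x (f (take l x))) \<le> F x u" if x: "x \<in> ?W" for x u
  proof (cases "real (count_list (erase_diff x (f (take l x))) None) \<le> ?t")
    case True
    have V: "take l x \<in> ?V" using x ln by (simp add: words_def)
    have len: "length (f (take l x)) = length x" using f(1)[OF V] x by (simp add: words_def)
    have "channel_output adv x = return_pmf (erase_diff x (f (take l x)))"
      unfolding adv_def using True f(2)[OF V] len by (intro channel_output_attack)
    then have "F x u = (\<Sum>y\<in>words n. if y = erase_diff x (f (take l x)) then D u y else 0)"
      unfolding F_def by (intro sum.cong refl) (simp add: indicator_def)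
    moreover have "erase_diff x (f (take l x)) \<in> words n"
      using len x by (simp add: words_def)
    ultimately show ?thesis using True by (simp add: finite_words)
  next
    case False
    then show ?thesis by (auto simp: F_def intro!: sum_nonneg mult_nonneg_nonneg D0)
  qed
  \<comment> \<open>The prefixes partition the message-word pairs.\<close>
  have split: "(\<Sum>w\<in>?V. \<Sum>a\<in>A w. g a) = (\<Sum>u\<in>?M. \<Sum>x\<in>?W. g (u, x))"
    for g :: "message \<times> bool list \<Rightarrow> real"
  proof -
    have "(\<Sum>w\<in>?V. \<Sum>a\<in>A w. g a) = sum g (\<Union>w\<in>?V. A w)"
      using finV finA by (intro sum.UNION_disjoint[symmetric]) (auto simp: A_def)
    also have "(\<Union>w\<in>?V. A w) = ?M \<times> ?W"
      using ln by (auto simp: A_def words_def)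
    finally show ?thesis by (simp add: sum.cartesian_product)
  qed
  have "(\<Sum>w\<in>?V. \<Sum>a\<in>A w. q a) = (\<Sum>u\<in>?M. 1 / m)"
    unfolding split using enc1
    by (intro sum.cong refl) (simp add: q_def sum_divide_distrib[symmetric])
  then have total: "(\<Sum>w\<in>?V. \<Sum>a\<in>A w. q a) = 1"
    using cardM m by simp
  have "(\<gamma> - 2 ^ l / m) / 2 = (\<Sum>w\<in>?V. (\<gamma> * (\<Sum>a\<in>A w. q a) - 1 / m) / 2)"
    unfolding sum_divide_distrib[symmetric] sum_subtractf sum_distrib_left[symmetric] total
    by (simp add: card_words_bool)
  also have "\<dots> \<le> (\<Sum>w\<in>?V. \<Sum>a\<in>A w. q a * F (snd a) (fst a))"
  proof (rule sum_mono)
    fix w assume w: "w \<in> ?V"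
    show "(\<gamma> * (\<Sum>a\<in>A w. q a) - 1 / m) / 2 \<le> (\<Sum>a\<in>A w. q a * F (snd a) (fst a))"
    proof (rule order_trans[OF f(3)[OF w]], unfold G_def, intro sum_mono mult_left_mono q0)
      fix a assume "a \<in> A w"
      then show "?E (snd a) (f w) * D (fst a) (erase_diff (snd a) (f w)) \<le> F (snd a) (fst a)"
        using F[of "snd a" "fst a"] by (cases a) (simp add: A_def)
    qed
  qed
  also have "\<dots> = (\<Sum>u\<in>?M. \<Sum>x\<in>?W. pmf (enc u) x * F x u) / m"
    by (simp add: split q_def sum_divide_distrib)
  also have "\<dots> \<le> (\<Sum>u\<in>?M. max_error r n enc dec adv) / m"
  proof (intro divide_right_mono sum_mono)
    fix u assume "u \<in> ?M"
    then show "(\<Sum>x\<in>?W. pmf (enc u) x * F x u) \<le> max_error r n enc dec adv"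
      unfolding max_error_def F_def D_def using finM by (intro Max_ge) auto
  qed (use m in simp)
  also have "\<dots> = max_error r n enc dec adv" using cardM m by simp
  finally show ?thesis
    using attack_in_CE[OF p] unfolding adv_def m_def by blast
qed

section \<open>Choice of parameters for rates above the bound\<close>

text \<open>For large \<open>n\<close> there are at least 2^s times as many messages as prefixes, so
  the attack forces an error of at least \<gamma>/4, whatever the code.\<close>

lemma not_achievable:
  assumes p: "0 \<le> p" "p \<le> 1" and R: "R > max (1 - 2 * p) 0"
  shows "\<not> achievable p R"
proof
  assume ach: "achievable p R"
  \<comment> \<open>Half the gap, so that the code rate \<open>r\<close> still exceeds the bound by
    \<epsilon>.\<close>
  define \<epsilon> where "\<epsilon> = (R - max (1 - 2 * p) 0) / 2"
  define r where "r = R - \<epsilon>"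
  \<comment> \<open>As p \<le> 1, the bound \<epsilon>/4 keeps the prefix lengthening 2 p \<gamma> n
    within \<epsilon> n / 2, half of the rate excess.\<close>
  define \<gamma> where "\<gamma> = min (\<epsilon> / 4) (1 / 2)"
  have \<epsilon>: "\<epsilon> > 0" using R by (simp add: \<epsilon>_def)
  have \<gamma>: "\<gamma> > 0" "\<gamma> \<le> 1" "\<gamma> \<le> \<epsilon> / 4" using \<epsilon> by (auto simp: \<gamma>_def)
  have r: "r = max (1 - 2 * p) 0 + \<epsilon>" by (simp add: r_def \<epsilon>_def field_simps)
  obtain enc dec N where code: "\<And>n. n \<ge> 1 \<Longrightarrow> is_code r n (enc n) (dec n)"
    and N: "\<And>n adv. n > N \<Longrightarrow> adv \<in> CE p n \<Longrightarrow> max_error r n (enc n) (dec n) adv < \<gamma> / 4"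
    using ach \<epsilon> \<gamma>(1) unfolding achievable_def r_def
    by (metis zero_less_divide_iff zero_less_numeral)
  obtain s :: nat where s: "(1 / 2 :: real) ^ s < \<gamma> / 2"
    using real_arch_pow_inv[of "\<gamma> / 2" "1 / 2"] \<gamma> by auto
  \<comment> \<open>Ensures n \<epsilon> / 2 \<ge> s + 1; the extra 1 pays for the floor in
    \<open>l\<close>.\<close>
  define n where "n = Suc (N + nat \<lceil>2 * (real s + 1) / \<epsilon>\<rceil>)"
  have n: "n > N" "n \<ge> 1" by (simp_all add: n_def)
  have "2 * (real s + 1) / \<epsilon> \<le> real n" unfolding n_def by linarith
  then have ns: "real s + 1 \<le> real n * \<epsilon> / 2" using \<epsilon> by (simp add: field_simps)
  define k where "k = nat \<lceil>real n * r\<rceil>"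
  \<comment> \<open>The shortest prefix that Plotkin's bound permits. Truncated subtraction gives 0
    when the floor exceeds \<open>n\<close>, which can happen for p > 1/2.\<close>
  define l where "l = n - nat \<lfloor>2 * p * real n * (1 - \<gamma>)\<rfloor>"
  have pn: "2 * p * real n * (1 - \<gamma>) \<ge> 0" using p \<gamma> by simp
  then have "real (nat \<lfloor>2 * p * real n * (1 - \<gamma>)\<rfloor>) \<le> 2 * p * real n * (1 - \<gamma>)"
    by linarith
  moreover have "n - l \<le> nat \<lfloor>2 * p * real n * (1 - \<gamma>)\<rfloor>" by (simp add: l_def)
  ultimately have l: "real (n - l) \<le> 2 * p * real n * (1 - \<gamma>)" by linarith
  have k: "real k \<ge> real n * r" unfolding k_def by linarith
  have lk: "l + s \<le> k"
  proof (cases "l = 0")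
    case True
    have "real n * \<epsilon> \<le> real n * r" by (intro mult_left_mono) (auto simp: r)
    moreover have "0 \<le> real n * \<epsilon>" using \<epsilon> by simp
    ultimately have "real s \<le> real k" using k ns by linarith
    with True show ?thesis by simp
  next
    case False
    then have "real l = real n - real (nat \<lfloor>2 * p * real n * (1 - \<gamma>)\<rfloor>)"
      unfolding l_def by simp
    then have "real l \<le> real n - 2 * p * real n * (1 - \<gamma>) + 1" using pn by linarith
    also have "\<dots> = real n * (1 - 2 * p + 2 * (p * \<gamma>)) + 1" by (simp add: algebra_simps)
    also have "p * \<gamma> \<le> \<epsilon> / 4" using mult_mono[OF p(2) \<gamma>(3)] \<gamma> by simp
    then have "real n * (1 - 2 * p + 2 * (p * \<gamma>)) + 1 \<le> real n * (r - \<epsilon> / 2) + 1"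
      by (intro add_right_mono mult_left_mono) (auto simp: r)
    also have "\<dots> = real n * r - real n * \<epsilon> / 2 + 1" by (simp add: algebra_simps)
    finally have "real l + real s \<le> real k" using k ns by linarith
    then show ?thesis by linarith
  qed
  have "(2::real) ^ l / 2 ^ k = 2 ^ l / 2 ^ (l + s + (k - (l + s)))" using lk by simp
  also have "\<dots> = (1 / 2) ^ s * (1 / 2) ^ (k - (l + s))"
    by (simp add: power_add power_divide)
  also have "\<dots> \<le> (1 / 2) ^ s * 1" by (intro mult_left_mono power_le_one) auto
  finally have "(2::real) ^ l / 2 ^ k \<le> \<gamma> / 2" using s by linarith
  moreover obtain adv where "adv \<in> CE p n"
    "(\<gamma> - 2 ^ l / 2 ^ k) / 2 \<le> max_error r n (enc n) (dec n) adv"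
    using exists_bad_adversary[OF p(1) code[OF n(2)] \<gamma>(2) _ l] unfolding k_def l_def by auto
  ultimately show False using N[OF n(1), of adv] by simp
qed

theorem theorem1:
  fixes p :: real
  assumes "0 \<le> p" and "p \<le> 1"
  shows "capacity p \<le> ereal (max (1 - 2 * p) 0)"
  unfolding capacity_def
proof (rule SUP_least)
  fix R assume "R \<in> {R. R \<ge> 0 \<and> achievable p R}"
  then have "R \<le> max (1 - 2 * p) 0" using not_achievable[OF assms, of R] by fastforce
  then show "ereal R \<le> ereal (max (1 - 2 * p) 0)" by (simp only: ereal_less_eq)
qed

end
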